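(* Let $n \geq 1$ and let $D: \mathcal{T}^{+}(\mathcal{C}_n) \rightarrow \mathcal{T}^{+}(\mathcal{C}_n)$ be a continuous derivation which is locally inner at $\varphi_{\lambda}$ for all $\lambda \in \mathbb{T}$. Then $D$ is inner, i.e. there exists $X \in \mathcal{T}^{+}(\mathcal{C}_n)$ such that $D(a) = aX - Xa$ for all $a \in \mathcal{T}^{+}(\mathcal{C}_n)$.
   Context: $\mathbb{T}$ is the unit circle. $A(\mathbb{D})$ is the disk algebra: functions holomorphic on the open unit disk $\mathbb{D}$ and continuous on $\overline{\mathbb{D}}$, with the supremum norm. For $1 \leq i,j \leq n$ let $\ell(i,j) \in \{0,1,\dots,n-1\}$ be the residue of $j-i$ modulo $n$. The algebra $\mathcal{T}^{+}(\mathcal{C}_n)$ is the subalgebra of $M_n \otimes A(\mathbb{D}) = M_n(A(\mathbb{D}))$ consisting of all matrices $[z^{\ell(i,j)} f_{i,j}(z^n)]_{i,j=1}^n$ with $f_{i,j} \in A(\mathbb{D})$ for all $i,j$, with the norm inherited from $M_n \otimes A(\mathbb{D})$ (the supremum over $z \in \overline{\mathbb{D}}$ of the operator norm of the matrix at $z$). For $\lambda \in \overline{\mathbb{D}}$, the representation $\varphi_{\lambda}: \mathcal{T}^{+}(\mathcal{C}_n) \to M_n$ is defined by $\varphi_{\lambda}([z^{\ell(i,j)} f_{i,j}(z^n)]) = [\lambda^{\ell(i,j)} f_{i,j}(\lambda^n)]$ (with $0^0=1$). A derivation on an algebra $A$ is a linear map $D: A \to A$ with $D(ab) = D(a)b +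 aD(b)$ for all $a,b\in A$. For a representation $\pi: A \to B(\mathcal{H})$ (a continuous representation by operators on a Hilbert space $\mathcal{H}$), a continuous derivation $D: A \to A$ is locally inner at $\pi$ if $\pi \circ D$ is inner at $\pi$, i.e. there is $X \in B(\mathcal{H})$ such that $\pi(D(a)) = \pi(a)X - X\pi(a)$ for all $a \in A$. *)

theory Defs
  imports "HOL-Complex_Analysis.Complex_Analysis"
begin

unbundle no fps_syntax

text \<open>
  Functions on the closed unit disk are represented by total functions on \<^typ>\<open>complex\<close> that
  vanish off the closed disk, so that equality of elements is equality of functions.
\<close>

definition disk_algebra :: "(complex \<Rightarrow> complex) set" where
  "disk_algebra =
     {f. continuous_on (cball 0 1) f \<and> f holomorphic_on ball 0 1 \<and> (\<forall>z. z \<notin> cball 0 1 \<longrightarrow> f z = 0)}"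

definition mat_disk_algebra :: "(complex \<Rightarrow> complex ^ 'n ^ 'n) set" where
  "mat_disk_algebra = {F. \<forall>i j. (\<lambda>z. F z $ i $ j) \<in> disk_algebra}"

text \<open>
  The map \<open>idx\<close> labels the finite index type by \<open>1, \<dots>, n\<close>, where \<open>n = CARD('n)\<close>.
\<close>

definition cyc_len :: "('n::finite \<Rightarrow> nat) \<Rightarrow> 'n \<Rightarrow> 'n \<Rightarrow> nat" where
  "cyc_len idx i j = nat ((int (idx j) - int (idx i)) mod int CARD('n))"

definition cyc_matrix ::
    "('n::finite \<Rightarrow> nat) \<Rightarrow> ('n \<Rightarrow> 'n \<Rightarrow> complex \<Rightarrow> complex) \<Rightarrow> complex \<Rightarrow> complex ^ 'n ^ 'n" where
  "cyc_matrix idx f = (\<lambda>z. \<chi> i j. z ^ cyc_len idx i j * f i j (z ^ CARD('n)))"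

definition cyc_algebra :: "('n::finite \<Rightarrow> nat) \<Rightarrow> (complex \<Rightarrow> complex ^ 'n ^ 'n) set" where
  "cyc_algebra idx =
     {F \<in> mat_disk_algebra. \<exists>f. (\<forall>i j. f i j \<in> disk_algebra) \<and> F = cyc_matrix idx f}"

text \<open>
  The ring multiplication of the type \<^typ>\<open>complex ^ 'n ^ 'n\<close> is entrywise, hence the explicit
  pointwise matrix product.
\<close>

definition fun_add ::
    "(complex \<Rightarrow> complex ^ 'n ^ 'n) \<Rightarrow> (complex \<Rightarrow> complex ^ 'n ^ 'n) \<Rightarrow> complex \<Rightarrow> complex ^ 'n ^ 'n" where
  "fun_add F G = (\<lambda>z. F z + G z)"

definition fun_diff ::
    "(complex \<Rightarrow> complex ^ 'n ^ 'n) \<Rightarrow> (complex \<Rightarrow> complex ^ 'n ^ 'n) \<Rightarrow> complex \<Rightarrow> complex ^ 'n ^ 'n" where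
  "fun_diff F G = (\<lambda>z. F z - G z)"

definition fun_scale ::
    "complex \<Rightarrow> (complex \<Rightarrow> complex ^ 'n ^ 'n) \<Rightarrow> complex \<Rightarrow> complex ^ 'n ^ 'n" where
  "fun_scale c F = (\<lambda>z. \<chi> i j. c * F z $ i $ j)"

definition fun_mult ::
    "(complex \<Rightarrow> complex ^ 'n ^ 'n) \<Rightarrow> (complex \<Rightarrow> complex ^ 'n ^ 'n) \<Rightarrow> complex \<Rightarrow> complex ^ 'n ^ 'n" where
  "fun_mult F G = (\<lambda>z. F z ** G z)"

definition sup_opnorm :: "(complex \<Rightarrow> complex ^ 'n ^ 'n) \<Rightarrow> real" where
  "sup_opnorm F = (SUP z\<in>cball 0 1. onorm (\<lambda>v. F z *v v))"

definition derivation_on ::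
    "(complex \<Rightarrow> complex ^ 'n ^ 'n) set
      \<Rightarrow> ((complex \<Rightarrow> complex ^ 'n ^ 'n) \<Rightarrow> complex \<Rightarrow> complex ^ 'n ^ 'n) \<Rightarrow> bool" where
  "derivation_on A D \<longleftrightarrow>
     (\<forall>a\<in>A. D a \<in> A) \<and>
     (\<forall>a\<in>A. \<forall>b\<in>A. D (fun_add a b) = fun_add (D a) (D b)) \<and>
     (\<forall>c. \<forall>a\<in>A. D (fun_scale c a) = fun_scale c (D a)) \<and>
     (\<forall>a\<in>A. \<forall>b\<in>A. D (fun_mult a b) = fun_add (fun_mult (D a) b) (fun_mult a (D b)))"

definition norm_continuous_on ::
    "(complex \<Rightarrow> complex ^ 'n ^ 'n) set
      \<Rightarrow> ((complex \<Rightarrow> complex ^ 'n ^ 'n) \<Rightarrow> complex \<Rightarrow> complex ^ 'n ^ 'n) \<Rightarrow> bool" where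
  "norm_continuous_on A D \<longleftrightarrow>
     (\<forall>a\<in>A. \<forall>\<epsilon>>0. \<exists>\<delta>>0. \<forall>b\<in>A.
        sup_opnorm (fun_diff b a) < \<delta> \<longrightarrow> sup_opnorm (fun_diff (D b) (D a)) < \<epsilon>)"

text \<open>
  As the elements of the algebra are functions, the representation at \<open>\<mu>\<close> is evaluation at \<open>\<mu>\<close>;
  see \<open>eval_rep_cyc_matrix\<close> for its effect on the coefficient functions.
\<close>

definition eval_rep :: "complex \<Rightarrow> (complex \<Rightarrow> complex ^ 'n ^ 'n) \<Rightarrow> complex ^ 'n ^ 'n" where
  "eval_rep \<mu> F = F \<mu>"

definition locally_inner_at ::
    "(complex \<Rightarrow> complex ^ 'n ^ 'n) set
      \<Rightarrow> ((complex \<Rightarrow> complex ^ 'n ^ 'n) \<Rightarrow> complex ^ 'n ^ 'n)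
      \<Rightarrow> ((complex \<Rightarrow> complex ^ 'n ^ 'n) \<Rightarrow> complex \<Rightarrow> complex ^ 'n ^ 'n) \<Rightarrow> bool" where
  "locally_inner_at A \<pi> D \<longleftrightarrow> (\<exists>X. \<forall>a\<in>A. \<pi> (D a) = \<pi> a ** X - X ** \<pi> a)"

definition inner_on ::
    "(complex \<Rightarrow> complex ^ 'n ^ 'n) set
      \<Rightarrow> ((complex \<Rightarrow> complex ^ 'n ^ 'n) \<Rightarrow> complex \<Rightarrow> complex ^ 'n ^ 'n) \<Rightarrow> bool" where
  "inner_on A D \<longleftrightarrow> (\<exists>X\<in>A. \<forall>a\<in>A. D a = fun_diff (fun_mult a X) (fun_mult X a))"

lemma eval_rep_cyc_matrix:
  "eval_rep \<mu> (cyc_matrix idx f :: complex \<Rightarrow> complex ^ 'n ^ 'n) =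
     (\<chi> i j. \<mu> ^ cyc_len idx i j * f i j (\<mu> ^ CARD('n)))"
  by (simp add: eval_rep_def cyc_matrix_def)

lemma disk_algebra_add: "f \<in> disk_algebra \<Longrightarrow> g \<in> disk_algebra \<Longrightarrow> (\<lambda>z. f z + g z) \<in> disk_algebra"
  and disk_algebra_mult: "f \<in> disk_algebra \<Longrightarrow> g \<in> disk_algebra \<Longrightarrow> (\<lambda>z. f z * g z) \<in> disk_algebra"
  unfolding disk_algebra_def
  by (simp_all add: continuous_on_add continuous_on_mult holomorphic_on_add holomorphic_on_mult)

lemma disk_algebra_pow_mult:
  assumes "f \<in> disk_algebra" shows "(\<lambda>z. z ^ k * f z) \<in> disk_algebra"
  using assms unfolding disk_algebra_def
  by (simp add: continuous_on_mult continuous_on_power holomorphic_on_mult holomorphic_on_power)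

lemma disk_algebra_sum:
  assumes "\<And>i. i \<in> I \<Longrightarrow> f i \<in> disk_algebra" shows "(\<lambda>z. \<Sum>i\<in>I. f i z) \<in> disk_algebra"
  using assms unfolding disk_algebra_def
  by (simp add: continuous_on_sum holomorphic_on_sum)

lemma disk_algebra_compose_pow:
  assumes f: "f \<in> disk_algebra" and "k > 0" shows "(\<lambda>z. f (z ^ k)) \<in> disk_algebra"
proof -
  have c: "(\<lambda>z::complex. z ^ k) ` cball 0 1 \<subseteq> cball 0 1"
    by (auto simp: norm_power power_le_one)
  have b: "(\<lambda>z::complex. z ^ k) ` ball 0 1 \<subseteq> ball 0 1"
    using \<open>k > 0\<close> by (auto simp: norm_power power_less_one_iff)
  have 1: "continuous_on (cball 0 1) (\<lambda>z. f (z ^ k))"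
    by (rule continuous_on_compose2[OF _ _ c])
      (use f in \<open>simp_all add: disk_algebra_def continuous_on_power\<close>)
  have "(f \<circ> (\<lambda>z. z ^ k)) holomorphic_on ball 0 1"
    by (rule holomorphic_on_compose_gen[OF _ _ b])
      (use f in \<open>simp_all add: disk_algebra_def holomorphic_on_power\<close>)
  moreover have "f (z ^ k) = 0" if "norm z > 1" for z
  proof -
    have "norm (z ^ k) > 1" using that \<open>k > 0\<close> by (simp add: norm_power one_less_power)
    then show ?thesis using f by (auto simp: disk_algebra_def)
  qed
  ultimately show ?thesis using 1 by (auto simp: disk_algebra_def o_def)
qed

lemma cyc_matrix_in_cyc_algebra:
  assumes "\<And>i j. f i j \<in> disk_algebra"
  shows "cyc_matrix idx f \<in> cyc_algebra idx"
proof -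
  have "(\<lambda>z. cyc_matrix idx f z $ i $ j) \<in> disk_algebra" for i j
    using disk_algebra_pow_mult[OF disk_algebra_compose_pow[OF assms]]
    by (simp add: cyc_matrix_def)
  then show ?thesis using assms by (auto simp: cyc_algebra_def mat_disk_algebra_def)
qed

lemma cyc_len_add:
  fixes idx :: "'n::finite \<Rightarrow> nat"
  shows "\<exists>q. cyc_len idx i k + cyc_len idx k j = cyc_len idx i j + CARD('n) * q"
proof -
  let ?n = "int CARD('n)"
  let ?a = "(int (idx k) - int (idx i)) mod ?n" and ?b = "(int (idx j) - int (idx k)) mod ?n"
  have "(?a + ?b) mod ?n = (int (idx j) - int (idx i)) mod ?n"
    by (simp add: mod_simps)
  then have eq: "?a + ?b = (int (idx j) - int (idx i)) mod ?n + ?n * ((?a + ?b) div ?n)"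
    by (metis mod_mult_div_eq)
  have nn: "?a \<ge> 0" "?b \<ge> 0" "(?a + ?b) div ?n \<ge> 0"
    by (auto simp: pos_imp_zdiv_nonneg_iff)
  have "int (cyc_len idx i k + cyc_len idx k j)
      = int (cyc_len idx i j + CARD('n) * nat ((?a + ?b) div ?n))"
    using eq nn by (simp add: cyc_len_def)
  then show ?thesis by (metis of_nat_eq_iff)
qed

lemma cyc_algebra_mult:
  fixes idx :: "'n::finite \<Rightarrow> nat"
  assumes "F \<in> cyc_algebra idx" "G \<in> cyc_algebra idx"
  shows "fun_mult F G \<in> cyc_algebra idx"
proof -
  obtain f g where f: "\<And>i j. f i j \<in> disk_algebra" "F = cyc_matrix idx f"
    and g: "\<And>i j. g i j \<in> disk_algebra" "G = cyc_matrix idx g"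
    using assms by (auto simp: cyc_algebra_def)
  obtain q where q: "\<And>i k j. cyc_len idx i k + cyc_len idx k j = cyc_len idx i j + CARD('n) * q i k j"
    using cyc_len_add[of idx] by metis
  define h where "h i j = (\<lambda>z. \<Sum>k\<in>UNIV. z ^ q i k j * (f i k z * g k j z))" for i j
  have h: "h i j \<in> disk_algebra" for i j
    unfolding h_def by (intro disk_algebra_sum disk_algebra_pow_mult disk_algebra_mult f g)
  have eq: "z ^ cyc_len idx i k * u * (z ^ cyc_len idx k j * v)
      = z ^ cyc_len idx i j * ((z ^ CARD('n)) ^ q i k j * (u * v))" for z u v :: complex and i j k
  proof -
    have "z ^ cyc_len idx i k * z ^ cyc_len idx k j = z ^ cyc_len idx i j * (z ^ CARD('n)) ^ q i k j"
      by (metis q power_add power_mult)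
    then show ?thesis by (simp add: mult_ac)
  qed
  have "fun_mult F G = cyc_matrix idx h"
    unfolding fun_mult_def f g
    by (simp only: fun_eq_iff vec_eq_iff cyc_matrix_def matrix_matrix_mult_def h_def
        sum_distrib_left vec_lambda_beta eq simp_thms)
  then show ?thesis using cyc_matrix_in_cyc_algebra h by metis
qed

end

theory Submission
  imports Defs
begin

unbundle no fps_syntax

text \<open>
  On the circle, \<open>D\<close> at \<open>\<mu>\<close> is the commutator with some matrix \<open>Y\<close>, which depends on \<open>\<mu>\<close> and is
  unique only up to a scalar. The values of \<open>D\<close> on the generators \<open>z ^ cyc_len i j \<cdot> E i j\<close> reveal the
  off-diagonal entries of \<open>Y\<close> and the differences of its diagonal entries. Normalised so that the
  \<open>(p, p)\<close> entry is \<open>0\<close>, the matrix \<open>Y\<close> is therefore the boundary value of an element \<open>X\<close> of the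
  algebra. Then \<open>D a\<close> and \<open>a X - X a\<close> agree on the circle, hence on the disk by the maximum
  principle.
\<close>

lemma disk_algebra_zero: "(\<lambda>z. 0) \<in> disk_algebra"
  by (simp add: disk_algebra_def)

text \<open>Elements must vanish off the closed disk, so this indicator, not the constant 1, is the
  unit of the disk algebra.\<close>

lemma disk_algebra_indicator: "indicator (cball 0 1) \<in> disk_algebra"
proof -
  have "continuous_on (cball 0 1) (indicator (cball 0 1) :: complex \<Rightarrow> complex)"
    by (rule continuous_on_eq[of _ "\<lambda>z. 1"]) auto
  moreover have "(indicator (cball 0 1) :: complex \<Rightarrow> complex) holomorphic_on ball 0 1"
    by (rule holomorphic_transform[of "\<lambda>z. 1"]) auto
  ultimately show ?thesis
    by (simp add: disk_algebra_def)
qed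

lemma disk_algebra_diff:
  "f \<in> disk_algebra \<Longrightarrow> g \<in> disk_algebra \<Longrightarrow> (\<lambda>z. f z - g z) \<in> disk_algebra"
  by (simp add: disk_algebra_def continuous_on_diff holomorphic_on_diff)

text \<open>The maximum modulus principle, applied to \<open>f - g\<close>, settles the closed disk;
  outside it both functions are 0 by convention.\<close>

lemma disk_algebra_eqI:
  assumes f: "f \<in> disk_algebra" and g: "g \<in> disk_algebra"
    and eq: "\<And>z. z \<in> sphere 0 1 \<Longrightarrow> f z = g z"
  shows "f = g"
proof
  fix z
  define h where "h = (\<lambda>z. f z - g z)"
  have h: "h \<in> disk_algebra"
    unfolding h_def by (rule disk_algebra_diff[OF f g])
  show "f z = g z"
  proof (cases "z \<in> cball 0 1")
    case True
    have "norm (h z) \<le> 0"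
    proof (rule maximum_modulus_frontier[where S = "cball 0 1" and f = h])
      show "h holomorphic_on interior (cball 0 1)"
        and "continuous_on (closure (cball 0 1)) h"
        using h by (simp_all add: disk_algebra_def)
      show "norm (h w) \<le> 0" if "w \<in> frontier (cball 0 1)" for w
        using that eq[of w] by (simp add: h_def)
    qed (use True in auto)
    then show ?thesis by (simp add: h_def)
  next
    case False
    then show ?thesis using f g by (simp add: disk_algebra_def)
  qed
qed

lemma mat_disk_algebra_eqI:
  assumes "F \<in> mat_disk_algebra" "G \<in> mat_disk_algebra"
    and "\<And>z. z \<in> sphere 0 1 \<Longrightarrow> F z = G z"
  shows "F = G"
proof -
  have "(\<lambda>z. F z $ i $ j) = (\<lambda>z. G z $ i $ j)" for i j
    using assms by (intro disk_algebra_eqI) (auto simp: mat_disk_algebra_def)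
  then show ?thesis by (simp add: fun_eq_iff vec_eq_iff)
qed

lemma fun_diff_in_mat_disk_algebra:
  "F \<in> mat_disk_algebra \<Longrightarrow> G \<in> mat_disk_algebra \<Longrightarrow> fun_diff F G \<in> mat_disk_algebra"
  by (simp add: mat_disk_algebra_def fun_diff_def disk_algebra_diff)

text \<open>Here \<open>U\<close> is \<open>c\<close> times a matrix unit: \<open>U ** Y\<close>
  moves row \<open>j\<close> of \<open>Y\<close> to row \<open>i\<close>, and \<open>Y ** U\<close>
  moves column \<open>i\<close> to column \<open>j\<close>.\<close>

lemma commutator_matrix_unit:
  fixes U Y :: "complex ^ 'n ^ 'n::finite"
  assumes "\<And>k l. U $ k $ l = (if k = i \<and> l = j then c else 0)"
  shows "(U ** Y - Y ** U) $ k $ l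
    = (if k = i then c * Y $ j $ l else 0) - (if l = j then Y $ k $ i * c else 0)"
proof -
  have "(\<Sum>m\<in>UNIV. U $ k $ m * Y $ m $ l)
      = (\<Sum>m\<in>UNIV. if m = j then (if k = i then c * Y $ j $ l else 0) else 0)"
    by (rule sum.cong) (auto simp: assms)
  moreover have "(\<Sum>m\<in>UNIV. Y $ k $ m * U $ m $ l)
      = (\<Sum>m\<in>UNIV. if m = i then (if l = j then Y $ k $ i * c else 0) else 0)"
    by (rule sum.cong) (auto simp: assms)
  ultimately show ?thesis
    by (simp add: matrix_matrix_mult_def)
qed

text \<open>Scalar matrices are central, so \<open>Y\<close> may be normalised without changing its
  commutators.\<close>

lemma commutator_diff_mat:
  fixes A Y :: "complex ^ 'n ^ 'n::finite"
  shows "A ** (Y - mat c) - (Y - mat c) ** A = A ** Y - Y ** A"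
proof -
  have "A ** mat c = mat c ** A"
    by (simp add: vec_eq_iff matrix_matrix_mult_def mat_def if_distrib if_distribR mult.commute
        cong: if_cong)
  then show ?thesis
    by (simp add: vec_eq_iff matrix_matrix_mult_def algebra_simps sum_subtractf)
qed

definition cyc_unit :: "('n::finite \<Rightarrow> nat) \<Rightarrow> 'n \<Rightarrow> 'n \<Rightarrow> complex \<Rightarrow> complex ^ 'n ^ 'n" where
  "cyc_unit idx i j =
     cyc_matrix idx (\<lambda>k l. if k = i \<and> l = j then indicator (cball 0 1) else (\<lambda>z. 0))"

lemma cyc_unit_in_cyc_algebra: "cyc_unit idx i j \<in> cyc_algebra idx"
  unfolding cyc_unit_def
  by (rule cyc_matrix_in_cyc_algebra) (simp add: disk_algebra_zero disk_algebra_indicator)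

lemma cyc_unit_nth:
  assumes "\<mu> \<in> sphere 0 1"
  shows "cyc_unit idx i j \<mu> $ k $ l = (if k = i \<and> l = j then \<mu> ^ cyc_len idx i j else 0)"
  using assms by (simp add: cyc_unit_def cyc_matrix_def norm_power)

lemma cyc_len_self [simp]: "cyc_len idx i i = 0"
  by (simp add: cyc_len_def)

theorem theorem4:
  fixes idx :: "'n::finite \<Rightarrow> nat"
    and D :: "(complex \<Rightarrow> complex ^ 'n ^ 'n) \<Rightarrow> complex \<Rightarrow> complex ^ 'n ^ 'n"
  assumes "bij_betw idx UNIV {1..CARD('n)}"
    and "derivation_on (cyc_algebra idx) D"
    and "norm_continuous_on (cyc_algebra idx) D"
    and "\<And>\<mu>. \<mu> \<in> sphere 0 1 \<Longrightarrow> locally_inner_at (cyc_algebra idx) (eval_rep \<mu>) D"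
  shows "inner_on (cyc_algebra idx) D"
proof -
  have D_in: "D a \<in> cyc_algebra idx" if "a \<in> cyc_algebra idx" for a
    using assms(2) that by (simp add: derivation_on_def)
  have "\<exists>g. (\<forall>k l. g k l \<in> disk_algebra) \<and> D (cyc_unit idx i j) = cyc_matrix idx g" for i j
    using D_in[OF cyc_unit_in_cyc_algebra] by (auto simp: cyc_algebra_def)
  then obtain g where g: "\<And>i j k l. g i j k l \<in> disk_algebra"
    and Dg: "\<And>i j. D (cyc_unit idx i j) = cyc_matrix idx (g i j)"
    by metis
  fix p :: 'n
  \<comment> \<open>The coefficients \<open>g\<close> do not depend on the point of the circle, so
    \<open>X\<close> is one element for all of them. Off the diagonal, the \<open>(i, j)\<close>
    entry of the commutator of \<open>cyc_unit idx i i\<close> with \<open>Y\<close> is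
    \<open>Y $ i $ j\<close>. On the diagonal, the \<open>(p, j)\<close> entry for
    \<open>cyc_unit idx p j\<close> gives \<open>Y $ j $ j - Y $ p $ p\<close> times a power of
    \<mu>.\<close>
  define X where "X = cyc_matrix idx (\<lambda>i j. if i = j then g p j p j else g i i i j)"
  have X_in: "X \<in> cyc_algebra idx"
    unfolding X_def by (rule cyc_matrix_in_cyc_algebra) (simp add: g)
  have "D a = fun_diff (fun_mult a X) (fun_mult X a)" if a: "a \<in> cyc_algebra idx" for a
  proof (rule mat_disk_algebra_eqI)
    show "D a \<in> mat_disk_algebra"
      using D_in[OF a] by (simp add: cyc_algebra_def)
    show "fun_diff (fun_mult a X) (fun_mult X a) \<in> mat_disk_algebra"
      using cyc_algebra_mult[OF a X_in] cyc_algebra_mult[OF X_in a]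
      by (intro fun_diff_in_mat_disk_algebra) (simp_all add: cyc_algebra_def)
  next
    fix \<mu> :: complex assume \<mu>: "\<mu> \<in> sphere 0 1"
    then obtain Y where Y: "\<And>b. b \<in> cyc_algebra idx \<Longrightarrow> D b \<mu> = b \<mu> ** Y - Y ** b \<mu>"
      using assms(4)[OF \<mu>] by (auto simp: locally_inner_at_def eval_rep_def)
    have \<mu>0: "\<mu> \<noteq> 0" using \<mu> by auto
    have gY: "\<mu> ^ cyc_len idx k l * g i j k l (\<mu> ^ CARD('n)) =
        (if k = i then \<mu> ^ cyc_len idx i j * Y $ j $ l else 0)
        - (if l = j then Y $ k $ i * \<mu> ^ cyc_len idx i j else 0)" for i j k l
    proof -
      have "\<mu> ^ cyc_len idx k l * g i j k l (\<mu> ^ CARD('n)) = D (cyc_unit idx i j) \<mu> $ k $ l"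
        by (simp add: Dg cyc_matrix_def)
      also have "\<dots> = (cyc_unit idx i j \<mu> ** Y - Y ** cyc_unit idx i j \<mu>) $ k $ l"
        by (simp only: Y[OF cyc_unit_in_cyc_algebra])
      finally show ?thesis
        using commutator_matrix_unit[OF cyc_unit_nth[OF \<mu>]] by metis
    qed
    \<comment> \<open>Both sides carry the same power of \<mu>, which cancels because \<mu> is
      nonzero on the circle.\<close>
    have diag: "g p j p j (\<mu> ^ CARD('n)) = Y $ j $ j - Y $ p $ p" for j
    proof -
      have "\<mu> ^ cyc_len idx p j * g p j p j (\<mu> ^ CARD('n))
          = \<mu> ^ cyc_len idx p j * (Y $ j $ j - Y $ p $ p)"
        by (simp add: gY[of p j p j] algebra_simps)
      then show ?thesis using \<mu>0 by simp
    qed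
    \<comment> \<open>Off the diagonal this is \<open>gY\<close> for
      \<open>cyc_unit idx i i\<close>, whose own power of \<mu> is 1; on the diagonal it is
      \<open>diag\<close>, as \<open>cyc_len idx i i\<close> is 0.\<close>
    have "X \<mu> = Y - mat (Y $ p $ p)"
      by (simp add: vec_eq_iff X_def cyc_matrix_def mat_def diag gY)
    then show "D a \<mu> = fun_diff (fun_mult a X) (fun_mult X a) \<mu>"
      by (simp add: Y[OF a] fun_diff_def fun_mult_def commutator_diff_mat)
  qed
  then show ?thesis
    using X_in by (auto simp: inner_on_def)
qed

end
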